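(* In the Com-IC model with $q_{\mathcal{A}|\emptyset}\le q_{\mathcal{A}|\mathcal{B}}$ and $q_{\mathcal{B}|\emptyset}=q_{\mathcal{B}|\mathcal{A}}$: (i) for any fixed $\mathcal{B}$-seed set $S_\mathcal{B}$, the set function $S_\mathcal{A}\mapsto\sigma_\mathcal{A}(S_\mathcal{A},S_\mathcal{B})$ is submodular; (ii) $\sigma_\mathcal{B}(S_\mathcal{A},S_\mathcal{B})$ does not depend on $S_\mathcal{A}$, and $S_\mathcal{B}\mapsto\sigma_\mathcal{B}(S_\mathcal{A},S_\mathcal{B})$ is submodular.
   Context: Com-IC model. Let $G=(V,E,p)$ be a directed graph with $p:E\to[0,1]$ and $N^-(v)$ the in-neighbours of $v$. Two items $\mathcal{A},\mathcal{B}$; GAPs $\mathbf{Q}=(q_{\mathcal{A}|\emptyset},q_{\mathcal{A}|\mathcal{B}},q_{\mathcal{B}|\emptyset},q_{\mathcal{B}|\mathcal{A}})\in[0,1]^4$. Given seed sets $S_\mathcal{A},S_\mathcal{B}\subseteq V$, randomness: each edge $(u,v)$ independently live w.p. $p(u,v)$; each node $v$ independently draws $\alpha^v_\mathcal{A},\alpha^v_\mathcal{B}$ uniform on $[0,1]$, a uniformly random permutation $\pi_v$ of $N^-(v)$, and a fair coin $\tau_v\in\{\mathcal{A},\mathcal{B}\}$. For each item $X$ each node is $X$-idle, $X$-suspended, $X$-adopted or $X$-rejected; initially all idle. At step $0$ nodes of $S_\mathcal{A}$ become $\mathcal{A}$-adopted and nodes of $S_\mathcal{B}$ become $\mathcal{B}$-adopted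 (order for nodes in both given by $\tau_v$). At step $t\ge1$, $v$ is informed of $X$ by in-neighbour $u$ if $(u,v)$ is live and $u$ adopted $X$ at step $t-1$; informing in-neighbours are processed in order $\pi_v$ (an in-neighbour that adopted both items is processed for both, in its adoption order). When $v$ is informed of $X$ ($Y$ the other item) while $X$-idle: if $Y$-adopted, $v$ becomes $X$-adopted if $\alpha^v_X\le q_{X|Y}$, else $X$-rejected; otherwise $X$-adopted if $\alpha^v_X\le q_{X|\emptyset}$, else $X$-suspended. Informing a non-$X$-idle node of $X$ has no effect. Reconsideration: when an $X$-suspended node becomes $Y$-adopted, it becomes $X$-adopted if $\alpha^v_X\le q_{X|Y}$, else $X$-rejected. The process stops when nothing changes. $\sigma_\mathcal{A}(S_\mathcal{A},S_\mathcal{B})$, $\sigma_\mathcal{B}(S_\mathcal{A},S_\mathcal{B})$ are the expected final numbers of $\mathcal{A}$-adopted, resp. $\mathcal{B}$-adopted, nodes. A set function $f$ on $2^V$ is submodular if $f(S\cup\{x\})-f(S)\ge f(T\cup\{x\})-f(T)$ for all $S\subseteq T\subseteq V$, $x\in V\setminus T$. *)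

theory Defs
  imports "HOL-Probability.Probability" "HOL-Combinatorics.Multiset_Permutations"
begin

text \<open>Com-IC model. Vertices are the elements of a finite type 'v (V = UNIV),
edges a set E of pairs, influence probabilities p (only values on E matter).
GAPs are a tuple Q = (qA0, qAB, qB0, qBA) = (q_{A|0}, q_{A|B}, q_{B|0}, q_{B|A}).\<close>

datatype item = IA | IB

fun other :: "item \<Rightarrow> item" where
  "other IA = IB" | "other IB = IA"

datatype status = Idle | Suspended | Adopted | Rejected

type_synonym gaps = "real \<times> real \<times> real \<times> real"

fun qcond :: "gaps \<Rightarrow> item \<Rightarrow> bool \<Rightarrow> real" where
  "qcond (a0, ab, b0, ba) IA b = (if b then ab else a0)"
| "qcond (a0, ab, b0, ba) IB b = (if b then ba else b0)"

definition in_nbrs :: "('v \<times> 'v) set \<Rightarrow> 'v \<Rightarrow> 'v set" where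
  "in_nbrs E v = {u. (u, v) \<in> E}"

text \<open>Node v is informed of item X. The state is v's status for each item together with
the list (in order) of items v has adopted during the current step.
alpha (v, X) is the threshold alpha^v_X.\<close>
definition inform :: "gaps \<Rightarrow> ('v \<times> item \<Rightarrow> real) \<Rightarrow> 'v \<Rightarrow> item
     \<Rightarrow> (item \<Rightarrow> status) \<times> item list \<Rightarrow> (item \<Rightarrow> status) \<times> item list" where
  "inform Q alpha v X sn =
     (let s = fst sn; new = snd sn; Y = other X in
      if s X \<noteq> Idle then (s, new)
      else if s Y = Adopted then
        (if alpha (v, X) \<le> qcond Q X True then (s(X := Adopted), new @ [X])
         else (s(X := Rejected), new))
      else if alpha (v, X) \<le> qcond Q X False then
        (if s Y = Suspended then
           (if alpha (v, Y) \<le> qcond Q Y True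
            then (s(X := Adopted, Y := Adopted), new @ [X, Y])
            else (s(X := Adopted, Y := Rejected), new @ [X]))
         else (s(X := Adopted), new @ [X]))
      else (s(X := Suspended), new))"

text \<open>Global state: status of every node for each item, and for every node the list of items
it adopted in the previous step (in adoption order).\<close>
type_synonym 'v state = "('v \<Rightarrow> item \<Rightarrow> status) \<times> ('v \<Rightarrow> item list)"

definition node_step :: "gaps \<Rightarrow> ('v \<times> 'v \<Rightarrow> bool) \<Rightarrow> ('v \<Rightarrow> 'v list)
     \<Rightarrow> ('v \<times> item \<Rightarrow> real) \<Rightarrow> 'v state \<Rightarrow> 'v \<Rightarrow> (item \<Rightarrow> status) \<times> item list" where
  "node_step Q live \<pi> alpha st v =
     fold (inform Q alpha v)
          (concat (map (\<lambda>u. if live (u, v) then snd st u else []) (\<pi> v)))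
          (fst st v, [])"

definition step :: "gaps \<Rightarrow> ('v \<times> 'v \<Rightarrow> bool) \<Rightarrow> ('v \<Rightarrow> 'v list)
     \<Rightarrow> ('v \<times> item \<Rightarrow> real) \<Rightarrow> 'v state \<Rightarrow> 'v state" where
  "step Q live \<pi> alpha st =
     ((\<lambda>v. fst (node_step Q live \<pi> alpha st v)), (\<lambda>v. snd (node_step Q live \<pi> alpha st v)))"

definition init_state :: "'v set \<Rightarrow> 'v set \<Rightarrow> ('v \<Rightarrow> item) \<Rightarrow> 'v state" where
  "init_state SA SB \<tau> =
     ((\<lambda>v X. if (X = IA \<and> v \<in> SA) \<or> (X = IB \<and> v \<in> SB) then Adopted else Idle),
      (\<lambda>v. if v \<in> SA \<and> v \<in> SB then (if \<tau> v = IA then [IA, IB] else [IB, IA])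
           else if v \<in> SA then [IA] else if v \<in> SB then [IB] else []))"

definition run :: "gaps \<Rightarrow> ('v \<times> 'v \<Rightarrow> bool) \<Rightarrow> ('v \<Rightarrow> 'v list) \<Rightarrow> ('v \<Rightarrow> item)
     \<Rightarrow> ('v \<times> item \<Rightarrow> real) \<Rightarrow> 'v set \<Rightarrow> 'v set \<Rightarrow> nat \<Rightarrow> 'v state" where
  "run Q live \<pi> \<tau> alpha SA SB n = (step Q live \<pi> alpha ^^ n) (init_state SA SB \<tau>)"

definition final_status :: "gaps \<Rightarrow> ('v \<times> 'v \<Rightarrow> bool) \<Rightarrow> ('v \<Rightarrow> 'v list) \<Rightarrow> ('v \<Rightarrow> item)
     \<Rightarrow> ('v \<times> item \<Rightarrow> real) \<Rightarrow> 'v set \<Rightarrow> 'v set \<Rightarrow> 'v \<Rightarrow> item \<Rightarrow> status" where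
  "final_status Q live \<pi> \<tau> alpha SA SB =
     fst (run Q live \<pi> \<tau> alpha SA SB
       (LEAST n. fst (run Q live \<pi> \<tau> alpha SA SB (Suc n)) = fst (run Q live \<pi> \<tau> alpha SA SB n)))"

definition num_adopted :: "gaps \<Rightarrow> ('v::finite \<times> 'v \<Rightarrow> bool) \<Rightarrow> ('v \<Rightarrow> 'v list) \<Rightarrow> ('v \<Rightarrow> item)
     \<Rightarrow> ('v \<times> item \<Rightarrow> real) \<Rightarrow> 'v set \<Rightarrow> 'v set \<Rightarrow> item \<Rightarrow> nat" where
  "num_adopted Q live \<pi> \<tau> alpha SA SB X =
     card {v. final_status Q live \<pi> \<tau> alpha SA SB v X = Adopted}"

definition discrete_outcome :: "('v::finite \<times> 'v) set \<Rightarrow> ('v \<times> 'v \<Rightarrow> real)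
     \<Rightarrow> (('v \<times> 'v \<Rightarrow> bool) \<times> ('v \<Rightarrow> 'v list) \<times> ('v \<Rightarrow> item)) pmf" where
  "discrete_outcome E p =
     pair_pmf (Pi_pmf E False (\<lambda>e. bernoulli_pmf (p e)))
       (pair_pmf (Pi_pmf UNIV [] (\<lambda>v. pmf_of_set (permutations_of_set (in_nbrs E v))))
                 (Pi_pmf UNIV IA (\<lambda>_. pmf_of_set {IA, IB})))"

definition alpha_measure :: "('v \<times> item \<Rightarrow> real) measure" where
  "alpha_measure = PiM UNIV (\<lambda>_. uniform_measure lborel {0..1})"

definition sigma :: "('v::finite \<times> 'v) set \<Rightarrow> ('v \<times> 'v \<Rightarrow> real) \<Rightarrow> gaps
     \<Rightarrow> item \<Rightarrow> 'v set \<Rightarrow> 'v set \<Rightarrow> real" where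
  "sigma E p Q X SA SB =
     measure_pmf.expectation (discrete_outcome E p)
       (\<lambda>(live, \<pi>, \<tau>). integral\<^sup>L alpha_measure
          (\<lambda>alpha. real (num_adopted Q live \<pi> \<tau> alpha SA SB X)))"

definition submodular :: "('a set \<Rightarrow> real) \<Rightarrow> bool" where
  "submodular f \<longleftrightarrow> (\<forall>S T x. S \<subseteq> T \<longrightarrow> x \<notin> T \<longrightarrow>
      f (insert x S) - f S \<ge> f (insert x T) - f T)"

end

theory Submission
  imports Defs
begin

text \<open>
  Fix one outcome of all random choices. Since \<open>q\<^bsub>B|0\<^esub> = q\<^bsub>B|A\<^esub>\<close>, item B is adopted exactly by the nodes
  reachable from the B-seeds along live edges into nodes \<open>v\<close> with \<open>\<alpha>\<^bsub>B\<^esub> \<le> q\<^bsub>B|0\<^esub>\<close>, whatever A does.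
  Because of reconsideration, it is irrelevant in which order A and B reach a node: once informed of A,
  \<open>v\<close> finally adopts A iff \<open>\<alpha>\<^bsub>A\<^esub> \<le> q\<^bsub>A|0\<^esub>\<close>, or \<open>\<alpha>\<^bsub>A\<^esub> \<le> q\<^bsub>A|B\<^esub>\<close> and \<open>v\<close> is B-reachable. So the A-adopters are
  again the nodes reachable from the A-seeds in a graph that does not depend on the A-seeds. The size
  of a reachable set is a coverage function of the seeds, hence submodular, and averaging over the
  outcomes preserves submodularity.
\<close>

section \<open>Submodular functions\<close>

text \<open>The marginal gain of \<open>x\<close> counts the points related to \<open>x\<close> that
  are not yet covered, and fewer of these remain when the seed set grows.\<close>

lemma submodular_card_Image:
  fixes R :: "('a \<times> 'b::finite) set"
  shows "submodular (\<lambda>S. real (card (R `` S)))"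
  unfolding submodular_def
proof (intro allI impI)
  fix S T :: "'a set" and x
  assume "S \<subseteq> T"
  have gain: "real (card (R `` insert x U)) - real (card (R `` U)) = real (card (R `` {x} - R `` U))" for U
  proof -
    have "R `` insert x U = (R `` {x} - R `` U) \<union> R `` U" by auto
    moreover have "card \<dots> = card (R `` {x} - R `` U) + card (R `` U)"
      by (rule card_Un_disjoint) auto
    ultimately show ?thesis by simp
  qed
  have "card (R `` {x} - R `` T) \<le> card (R `` {x} - R `` S)"
    by (rule card_mono) (use \<open>S \<subseteq> T\<close> in auto)
  then show "real (card (R `` insert x T)) - real (card (R `` T))
      \<le> real (card (R `` insert x S)) - real (card (R `` S))"
    by (simp only: gain of_nat_le_iff)
qed

text \<open>Monotonicity of the integral, applied to marginal gains. It serves both for the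
  thresholds and for the discrete randomness.\<close>

lemma submodular_integral:
  fixes f :: "'b \<Rightarrow> 'a set \<Rightarrow> real"
  assumes "\<And>S. integrable M (\<lambda>\<omega>. f \<omega> S)" and "\<And>\<omega>. submodular (f \<omega>)"
  shows "submodular (\<lambda>S. \<integral>\<omega>. f \<omega> S \<partial>M)"
  unfolding submodular_def
proof (intro allI impI)
  fix S T :: "'a set" and x
  assume "S \<subseteq> T" "x \<notin> T"
  then have "(\<integral>\<omega>. f \<omega> (insert x T) - f \<omega> T \<partial>M) \<le> (\<integral>\<omega>. f \<omega> (insert x S) - f \<omega> S \<partial>M)"
    using assms by (intro integral_mono) (auto simp: submodular_def)
  then show "(\<integral>\<omega>. f \<omega> (insert x T) \<partial>M) - (\<integral>\<omega>. f \<omega> T \<partial>M)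
      \<le> (\<integral>\<omega>. f \<omega> (insert x S) \<partial>M) - (\<integral>\<omega>. f \<omega> S \<partial>M)"
    using assms(1) by simp
qed

section \<open>Dynamics of a single outcome\<close>

fun rank :: "status \<Rightarrow> nat" where
  "rank Idle = 0" | "rank Suspended = 1" | "rank Adopted = 2" | "rank Rejected = 2"

lemma rank_le_2: "rank s \<le> 2"
  by (cases s) auto

text \<open>\<open>Adopted\<close> and \<open>Rejected\<close> share the top rank, so they are
  incomparable and maximal: neither can be left once entered.\<close>

definition status_le :: "status \<Rightarrow> status \<Rightarrow> bool" where
  "status_le s t \<longleftrightarrow> s = t \<or> rank s < rank t"

lemma status_le_refl: "status_le s s"
  by (simp add: status_le_def)

lemma status_le_trans: "status_le s t \<Longrightarrow> status_le t u \<Longrightarrow> status_le s u"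
  by (auto simp: status_le_def)

lemma status_le_Adopted: "status_le Adopted s \<Longrightarrow> s = Adopted"
  using rank_le_2[of s] by (auto simp: status_le_def)

lemma status_le_not_Idle: "status_le s t \<Longrightarrow> s \<noteq> Idle \<Longrightarrow> t \<noteq> Idle"
  by (auto simp: status_le_def)

lemma all_item: "(\<forall>X. P X) \<longleftrightarrow> P IA \<and> P IB"
  by (metis item.exhaust)

lemma inform_status_le: "status_le (fst sn Z) (fst (inform Q alpha v X sn) Z)"
  by (cases X; cases Z; cases "fst sn IA"; cases "fst sn IB")
     (auto simp: inform_def Let_def status_le_def)

lemma inform_not_Idle: "fst (inform Q alpha v X sn) X \<noteq> Idle"
  by (cases X) (auto simp: inform_def Let_def)

lemma fold_inform_status_le: "status_le (fst sn Z) (fst (fold (inform Q alpha v) xs sn) Z)"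
proof (induction xs arbitrary: sn)
  case (Cons X xs)
  show ?case
    using status_le_trans[OF inform_status_le Cons.IH] by simp
qed (simp add: status_le_refl)

lemma fold_inform_not_Idle:
  "X \<in> set xs \<Longrightarrow> fst (fold (inform Q alpha v) xs sn) X \<noteq> Idle"
proof (induction xs arbitrary: sn)
  case (Cons Y xs)
  have "fst (fold (inform Q alpha v) xs (inform Q alpha v Y sn)) Y \<noteq> Idle"
    by (rule status_le_not_Idle[OF fold_inform_status_le inform_not_Idle])
  with Cons show ?case by (cases "X = Y") simp_all
qed simp

text \<open>\<open>s0\<close> is the status at the start of the step. The second premise ensures
  that an item adopted only now was not adopted in \<open>s0\<close>.\<close>

lemma inform_new_iff:
  assumes "\<forall>X. X \<in> set (snd sn) \<longleftrightarrow> fst sn X = Adopted \<and> s0 X \<noteq> Adopted"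
    and "\<forall>X. s0 X = Adopted \<longrightarrow> fst sn X = Adopted"
  shows "\<forall>X. X \<in> set (snd (inform Q alpha v Y sn)) \<longleftrightarrow>
    fst (inform Q alpha v Y sn) X = Adopted \<and> s0 X \<noteq> Adopted"
  using assms unfolding all_item by (cases Y) (auto simp: inform_def Let_def)

lemma fold_inform_new_iff:
  assumes "\<forall>X. X \<in> set (snd sn) \<longleftrightarrow> fst sn X = Adopted \<and> s0 X \<noteq> Adopted"
    and "\<forall>X. s0 X = Adopted \<longrightarrow> fst sn X = Adopted"
  shows "X \<in> set (snd (fold (inform Q alpha v) xs sn)) \<longleftrightarrow>
    fst (fold (inform Q alpha v) xs sn) X = Adopted \<and> s0 X \<noteq> Adopted"
  using assms
proof (induction xs arbitrary: sn)
  case (Cons Y xs)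
  have "\<forall>X. s0 X = Adopted \<longrightarrow> fst (inform Q alpha v Y sn) X = Adopted"
    using Cons.prems(2) inform_status_le[of sn _ Q alpha v Y] by (metis status_le_Adopted)
  with Cons.IH[OF inform_new_iff[OF Cons.prems]] show ?case by simp
qed simp

lemma step_status_le: "status_le (fst st v X) (fst (step Q live \<pi> alpha st) v X)"
  unfolding step_def node_step_def
  using fold_inform_status_le[of "(fst st v, [])"] by simp

lemma step_new_iff:
  "X \<in> set (snd (step Q live \<pi> alpha st) v) \<longleftrightarrow>
    fst (step Q live \<pi> alpha st) v X = Adopted \<and> fst st v X \<noteq> Adopted"
  unfolding step_def node_step_def
  using fold_inform_new_iff[of "(fst st v, [])" "fst st v"] by simp

lemma step_informed_not_Idle:
  assumes "X \<in> set (snd st u)" "u \<in> set (\<pi> v)" "live (u, v)"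
  shows "fst (step Q live \<pi> alpha st) v X \<noteq> Idle"
proof -
  have "X \<in> set (concat (map (\<lambda>u. if live (u, v) then snd st u else []) (\<pi> v)))"
    using assms by auto
  from fold_inform_not_Idle[OF this] show ?thesis
    unfolding step_def node_step_def by simp
qed

section \<open>Stabilisation of the run and its final state\<close>

lemma run_0: "run Q live \<pi> \<tau> alpha SA SB 0 = init_state SA SB \<tau>"
  by (simp add: run_def)

lemma run_Suc: "run Q live \<pi> \<tau> alpha SA SB (Suc n) = step Q live \<pi> alpha (run Q live \<pi> \<tau> alpha SA SB n)"
  by (simp add: run_def)

text \<open>Makes the \<open>LEAST\<close> in \<open>final_status\<close> meaningful. The total rank
  over all nodes and items grows strictly while any status changes, yet it never exceeds 4 per
  node.\<close>

lemma run_becomes_stationary: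
  fixes live :: "'v::finite \<times> 'v \<Rightarrow> bool"
  shows "\<exists>n. fst (run Q live \<pi> \<tau> alpha SA SB (Suc n)) = fst (run Q live \<pi> \<tau> alpha SA SB n)"
proof (rule ccontr)
  define r where "r = run Q live \<pi> \<tau> alpha SA SB"
  define \<mu> where "\<mu> n = (\<Sum>v\<in>UNIV. rank (fst (r n) v IA) + rank (fst (r n) v IB))" for n
  assume "\<nexists>n. fst (run Q live \<pi> \<tau> alpha SA SB (Suc n)) = fst (run Q live \<pi> \<tau> alpha SA SB n)"
  then have change: "fst (r (Suc n)) \<noteq> fst (r n)" for n
    by (simp add: r_def)
  have le: "status_le (fst (r n) v X) (fst (r (Suc n)) v X)" for n v X
    by (simp add: r_def run_Suc step_status_le)
  then have rank_le: "rank (fst (r n) v X) \<le> rank (fst (r (Suc n)) v X)" for n v X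
    by (metis less_imp_le order_refl status_le_def)
  have "\<mu> n < \<mu> (Suc n)" for n
  proof -
    obtain v X where "fst (r (Suc n)) v X \<noteq> fst (r n) v X"
      using change[of n] by (meson ext)
    then have lt: "rank (fst (r n) v X) < rank (fst (r (Suc n)) v X)"
      using le[of n v X] by (auto simp: status_le_def)
    show ?thesis unfolding \<mu>_def
    proof (rule sum_strict_mono_ex1)
      show "\<exists>w\<in>UNIV. rank (fst (r n) w IA) + rank (fst (r n) w IB)
          < rank (fst (r (Suc n)) w IA) + rank (fst (r (Suc n)) w IB)"
        using lt rank_le[of n v IA] rank_le[of n v IB] by (cases X) (auto intro!: exI[of _ v])
    qed (auto intro: add_mono rank_le)
  qed
  then have "n \<le> \<mu> n" for n
    by (simp add: strict_mono_Suc_iff strict_mono_imp_increasing)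
  moreover have "\<mu> n \<le> 4 * CARD('v)" for n
  proof -
    have "\<mu> n \<le> (\<Sum>v\<in>(UNIV::'v set). 4)"
      unfolding \<mu>_def by (rule sum_mono) (use add_mono[OF rank_le_2 rank_le_2] in simp)
    then show ?thesis by simp
  qed
  ultimately show False
    by (metis Suc_n_not_le_n le_trans)
qed

lemma run_status_le_init: "status_le (fst (init_state SA SB \<tau>) v X) (fst (run Q live \<pi> \<tau> alpha SA SB n) v X)"
proof (induction n)
  case (Suc n)
  then show ?case
    unfolding run_Suc by (rule status_le_trans[OF _ step_status_le])
qed (simp add: run_0 status_le_refl)

text \<open>An adoption that is no longer new was listed as new at some earlier step, and the step
  after that one informed \<open>v\<close>. Seeds are listed at step 0, so the base case is
  vacuous.\<close>

lemma run_informed: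
  assumes "fst (run Q live \<pi> \<tau> alpha SA SB n) u X = Adopted"
    and "X \<notin> set (snd (run Q live \<pi> \<tau> alpha SA SB n) u)"
    and "u \<in> set (\<pi> v)" "live (u, v)"
  shows "fst (run Q live \<pi> \<tau> alpha SA SB n) v X \<noteq> Idle"
  using assms(1,2)
proof (induction n)
  case 0
  then show ?case by (auto simp: run_0 init_state_def split: if_splits)
next
  case (Suc n)
  let ?r = "run Q live \<pi> \<tau> alpha SA SB n"
  from Suc.prems have adopted: "fst ?r u X = Adopted"
    by (auto simp: run_Suc step_new_iff)
  show ?case
  proof (cases "X \<in> set (snd ?r u)")
    case True
    then show ?thesis using step_informed_not_Idle assms(3,4) by (simp add: run_Suc)
  next
    case False
    with Suc.IH adopted show ?thesis
      using status_le_not_Idle[OF step_status_le] by (simp add: run_Suc)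
  qed
qed

lemma final_status_eq_run:
  fixes live :: "'v::finite \<times> 'v \<Rightarrow> bool"
  obtains n where "final_status Q live \<pi> \<tau> alpha SA SB = fst (run Q live \<pi> \<tau> alpha SA SB n)"
    and "\<And>v. snd (run Q live \<pi> \<tau> alpha SA SB n) v = []"
proof -
  define n where "n = (LEAST n. fst (run Q live \<pi> \<tau> alpha SA SB (Suc n)) = fst (run Q live \<pi> \<tau> alpha SA SB n))"
  have eq: "fst (run Q live \<pi> \<tau> alpha SA SB (Suc n)) = fst (run Q live \<pi> \<tau> alpha SA SB n)"
    unfolding n_def by (rule LeastI_ex[OF run_becomes_stationary])
  \<comment> \<open>The state is read at \<open>Suc n\<close>: at \<open>n\<close> some adoptions
    may still be new, but a step that changes no status leaves all lists empty.\<close>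
  then have "final_status Q live \<pi> \<tau> alpha SA SB = fst (run Q live \<pi> \<tau> alpha SA SB (Suc n))"
    by (simp add: final_status_def n_def)
  moreover have "set (snd (run Q live \<pi> \<tau> alpha SA SB (Suc n)) v) = {}" for v
    using step_new_iff[of _ Q live \<pi> alpha "run Q live \<pi> \<tau> alpha SA SB n" v] eq
    unfolding run_Suc by fastforce
  ultimately show ?thesis using that by auto
qed

text \<open>With no adoption pending, \<open>run_informed\<close> applies to every adopter, so the
  final state is closed under passing information along live edges.\<close>

lemma final_status_informed:
  fixes live :: "'v::finite \<times> 'v \<Rightarrow> bool"
  assumes "final_status Q live \<pi> \<tau> alpha SA SB u X = Adopted" "u \<in> set (\<pi> v)" "live (u, v)"
  shows "final_status Q live \<pi> \<tau> alpha SA SB v X \<noteq> Idle"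
proof -
  obtain n where "final_status Q live \<pi> \<tau> alpha SA SB = fst (run Q live \<pi> \<tau> alpha SA SB n)"
    and "\<And>v. snd (run Q live \<pi> \<tau> alpha SA SB n) v = []"
    using final_status_eq_run[of Q live \<pi> \<tau> alpha SA SB] by metis
  with run_informed[of Q live \<pi> \<tau> alpha SA SB n u X v] assms show ?thesis by simp
qed

lemma final_status_seed:
  fixes live :: "'v::finite \<times> 'v \<Rightarrow> bool"
  assumes "fst (init_state SA SB \<tau>) v X = Adopted"
  shows "final_status Q live \<pi> \<tau> alpha SA SB v X = Adopted"
  unfolding final_status_def
  by (rule status_le_Adopted) (subst assms[symmetric], rule run_status_le_init)

section \<open>Adopters as reachable sets\<close>

text \<open>Only heads of edges must lie in \<open>W\<close>; seeds are reached unconditionally,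
  just as they adopt without a threshold test.\<close>

definition reach :: "('v \<times> 'v \<Rightarrow> bool) \<Rightarrow> ('v \<Rightarrow> 'v list) \<Rightarrow> 'v set \<Rightarrow> ('v \<times> 'v) set" where
  "reach live \<pi> W = {(u, v). u \<in> set (\<pi> v) \<and> live (u, v) \<and> v \<in> W}\<^sup>*"

lemma reach_step:
  "u \<in> reach live \<pi> W `` S \<Longrightarrow> u \<in> set (\<pi> v) \<Longrightarrow> live (u, v) \<Longrightarrow> v \<in> W \<Longrightarrow> v \<in> reach live \<pi> W `` S"
  unfolding reach_def by (auto intro: rtrancl_into_rtrancl)

lemma reach_seed: "v \<in> S \<Longrightarrow> v \<in> reach live \<pi> W `` S"
  unfolding reach_def by auto

lemma reach_induct [consumes 1, case_names seed step]:
  assumes "v \<in> reach live \<pi> W `` S"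
    and "\<And>v. v \<in> S \<Longrightarrow> P v"
    and "\<And>u v. P u \<Longrightarrow> u \<in> set (\<pi> v) \<Longrightarrow> live (u, v) \<Longrightarrow> v \<in> W \<Longrightarrow> P v"
  shows "P v"
proof -
  from assms(1) obtain s where "s \<in> S" "(s, v) \<in> {(u, v). u \<in> set (\<pi> v) \<and> live (u, v) \<and> v \<in> W}\<^sup>*"
    by (auto simp: reach_def)
  from this(2,1) show ?thesis
    by (induction rule: rtrancl_induct) (auto intro: assms(2,3))
qed

section \<open>An invariant tying the run to the reachable sets\<close>

locale outcome =
  fixes live :: "'v::finite \<times> 'v \<Rightarrow> bool" and \<pi> :: "'v \<Rightarrow> 'v list" and \<tau> :: "'v \<Rightarrow> item"
    and alpha :: "'v \<times> item \<Rightarrow> real" and SA SB :: "'v set" and qA0 qAB qB :: real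
  assumes qA0_le_qAB: "qA0 \<le> qAB"
begin

abbreviation "Q \<equiv> (qA0, qAB, qB, qB)"
abbreviation "the_run \<equiv> run Q live \<pi> \<tau> alpha SA SB"
abbreviation "the_final \<equiv> final_status Q live \<pi> \<tau> alpha SA SB"

definition RB :: "'v set" where
  "RB = reach live \<pi> {v. alpha (v, IB) \<le> qB} `` SB"

definition okA :: "'v set" where
  "okA = {v. alpha (v, IA) \<le> qA0} \<union> {v. alpha (v, IA) \<le> qAB} \<inter> RB"

definition RA :: "'v set" where
  "RA = reach live \<pi> okA `` SA"

fun adopters :: "item \<Rightarrow> 'v set" where
  "adopters IA = RA" | "adopters IB = RB"

text \<open>Refers to the predicted adopters instead of the current state, so that the invariant
  \<open>sound\<close> is independent of time.\<close>

definition informed :: "item \<Rightarrow> 'v \<Rightarrow> bool" where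
  "informed X v \<longleftrightarrow> (\<exists>u\<in>adopters X. u \<in> set (\<pi> v) \<and> live (u, v))"

lemma informed_IA: "informed IA v \<Longrightarrow> v \<in> okA \<Longrightarrow> v \<in> RA"
  unfolding informed_def by (auto simp: RA_def intro: reach_step)

lemma informed_IB: "informed IB v \<Longrightarrow> alpha (v, IB) \<le> qB \<Longrightarrow> v \<in> RB"
  unfolding informed_def by (auto simp: RB_def intro: reach_step)

text \<open>Suspension and rejection for \<open>IB\<close> mean the same because both thresholds
  equal \<open>qB\<close>. The clause for A-suspension remembers that \<open>v\<close> was informed,
  for use at a reconsideration, and records that no reconsideration is outstanding.\<close>

definition sound :: "'v \<Rightarrow> (item \<Rightarrow> status) \<Rightarrow> bool" where
  "sound v s \<longleftrightarrow>
     (s IB = Adopted \<longrightarrow> v \<in> RB) \<and>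
     (s IB \<in> {Suspended, Rejected} \<longrightarrow> qB < alpha (v, IB)) \<and>
     (s IA = Adopted \<longrightarrow> v \<in> RA) \<and>
     (s IA = Suspended \<longrightarrow> informed IA v \<and> qA0 < alpha (v, IA) \<and> s IB \<noteq> Adopted) \<and>
     (s IA = Rejected \<longrightarrow> qAB < alpha (v, IA))"

text \<open>The critical case is B adopted while A is suspended: \<open>v\<close> is then in
  \<open>RB\<close>, so \<open>alpha (v, IA) \<le> qAB\<close> puts it in \<open>okA\<close>, and
  the remembered information puts it in \<open>RA\<close>. Conversely, adopting A never rescues a
  suspended B, whose threshold already exceeds \<open>qB\<close>.\<close>

lemma sound_inform:
  assumes "sound v (fst sn)" "informed X v"
  shows "sound v (fst (inform Q alpha v X sn))"
proof (cases X)
  case IA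
  have okA_iff: "v \<in> okA \<longleftrightarrow> alpha (v, IA) \<le> qA0 \<or> alpha (v, IA) \<le> qAB \<and> v \<in> RB"
    by (auto simp: okA_def)
  show ?thesis
    using assms informed_IA[of v] unfolding sound_def okA_iff IA
    by (cases "fst sn IB") (auto simp: inform_def Let_def)
next
  case IB
  have okA_iff: "v \<in> okA \<longleftrightarrow> alpha (v, IA) \<le> qA0 \<or> alpha (v, IA) \<le> qAB \<and> v \<in> RB"
    by (auto simp: okA_def)
  show ?thesis
    using assms informed_IA[of v] informed_IB[of v] unfolding sound_def okA_iff IB
    by (cases "fst sn IA") (auto simp: inform_def Let_def)
qed

lemma sound_fold_inform:
  "sound v (fst sn) \<Longrightarrow> (\<And>X. X \<in> set xs \<Longrightarrow> informed X v) \<Longrightarrow>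
    sound v (fst (fold (inform Q alpha v) xs sn))"
proof (induction xs arbitrary: sn)
  case (Cons X xs)
  then have "sound v (fst (inform Q alpha v X sn))"
    by (intro sound_inform) auto
  with Cons show ?case by simp
qed simp

lemma run_new_adopted:
  "X \<in> set (snd (the_run n) v) \<Longrightarrow> fst (the_run n) v X = Adopted"
  by (cases n) (auto simp: run_0 run_Suc step_new_iff init_state_def split: if_splits)

lemma sound_Adopted: "sound v s \<Longrightarrow> s X = Adopted \<Longrightarrow> v \<in> adopters X"
  by (cases X) (auto simp: sound_def)

text \<open>Gives the inclusion of actual adopters in the predicted sets. The induction generalises
  over \<open>v\<close> since it is applied to the informing neighbours as well.\<close>

lemma sound_run: "sound v (fst (the_run n) v)"
proof (induction n arbitrary: v)
  case 0
  show ?case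
    by (auto simp: run_0 init_state_def sound_def RA_def RB_def intro: reach_seed)
next
  case (Suc n)
  let ?xs = "concat (map (\<lambda>u. if live (u, v) then snd (the_run n) u else []) (\<pi> v))"
  have "informed X v" if X: "X \<in> set ?xs" for X
  proof -
    from X obtain u where u: "u \<in> set (\<pi> v)" "live (u, v)" "X \<in> set (snd (the_run n) u)"
      by (auto split: if_splits)
    then have "u \<in> adopters X"
      using run_new_adopted sound_Adopted Suc.IH by blast
    with u show ?thesis by (auto simp: informed_def)
  qed
  then have "sound v (fst (fold (inform Q alpha v) ?xs (fst (the_run n) v, [])))"
    by (intro sound_fold_inform) (use Suc.IH in auto)
  then show ?case by (simp add: run_Suc step_def node_step_def)
qed

lemma sound_final: "sound v (the_final v)"
  unfolding final_status_def by (rule sound_run)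

lemma final_IB_iff: "the_final v IB = Adopted \<longleftrightarrow> v \<in> RB"
proof
  assume "v \<in> RB"
  then show "the_final v IB = Adopted"
    unfolding RB_def
  proof (induction rule: reach_induct)
    case (seed v)
    then show ?case by (intro final_status_seed) (simp add: init_state_def)
  next
    case (step u v)
    then have "the_final v IB \<noteq> Idle" by (intro final_status_informed)
    \<comment> \<open>An informed node that failed to adopt B would have
      \<open>qB < alpha (v, IB)\<close>, contradicting that it is the head of an edge used by
      \<open>reach\<close>.\<close>
    with step sound_final[of v] show ?case
      by (cases "the_final v IB") (auto simp: sound_def)
  qed
next
  assume "the_final v IB = Adopted"
  with sound_final[of v] show "v \<in> RB" by (simp add: sound_def)
qed

lemma final_IA_iff: "the_final v IA = Adopted \<longleftrightarrow> v \<in> RA"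
proof
  assume "v \<in> RA"
  then show "the_final v IA = Adopted"
    unfolding RA_def
  proof (induction rule: reach_induct)
    case (seed v)
    then show ?case by (intro final_status_seed) (simp add: init_state_def)
  next
    case (step u v)
    then have "the_final v IA \<noteq> Idle" by (intro final_status_informed)
    \<comment> \<open>If A were suspended, B would not be adopted, so \<open>v\<close> would lie
      outside \<open>RB\<close> and its threshold would exceed \<open>qA0\<close>. If A were
      rejected, the threshold would exceed \<open>qAB\<close>, hence also \<open>qA0\<close>. Both
      contradict membership in \<open>okA\<close>.\<close>
    with step sound_final[of v] final_IB_iff[of v] qA0_le_qAB show ?case
      by (cases "the_final v IA") (auto simp: sound_def okA_def)
  qed
next
  assume "the_final v IA = Adopted"
  with sound_final[of v] show "v \<in> RA" by (simp add: sound_def)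
qed

end

text \<open>The absence of \<open>SA\<close> on the right yields the independence claimed in
  (ii).\<close>

lemma num_adopted_IB:
  assumes "qA0 \<le> qAB"
  shows "num_adopted (qA0, qAB, qB, qB) live \<pi> \<tau> alpha SA SB IB =
    card (reach live \<pi> {v. alpha (v, IB) \<le> qB} `` SB)"
proof -
  interpret outcome live \<pi> \<tau> alpha SA SB qA0 qAB qB
    by unfold_locales (fact assms)
  show ?thesis by (simp add: num_adopted_def final_IB_iff RB_def)
qed

text \<open>\<open>SA\<close> occurs only as the set whose image is taken, which gives
  submodularity; \<open>alpha\<close> occurs only through three threshold sets, which gives
  measurability.\<close>

lemma num_adopted_IA:
  assumes "qA0 \<le> qAB"
  shows "num_adopted (qA0, qAB, qB, qB) live \<pi> \<tau> alpha SA SB IA =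
    card (reach live \<pi> ({v. alpha (v, IA) \<le> qA0} \<union>
      {v. alpha (v, IA) \<le> qAB} \<inter> reach live \<pi> {v. alpha (v, IB) \<le> qB} `` SB) `` SA)"
proof -
  interpret outcome live \<pi> \<tau> alpha SA SB qA0 qAB qB
    by unfold_locales (fact assms)
  show ?thesis by (simp add: num_adopted_def final_IA_iff RA_def okA_def RB_def)
qed

section \<open>Averaging over the outcomes\<close>

lemma prob_space_alpha_measure: "prob_space (alpha_measure :: ('v::finite \<times> item \<Rightarrow> real) measure)"
  unfolding alpha_measure_def
  by (intro prob_space_PiM prob_space_uniform_measure) auto

text \<open>There are finitely many values \<open>W\<close>, and the preimage of each is a finite
  conjunction of threshold conditions on coordinates.\<close>

lemma measurable_threshold_set:
  "(\<lambda>alpha. {v. alpha (v, X) \<le> c}) \<in> measurable (alpha_measure :: ('v::finite \<times> item \<Rightarrow> real) measure) (count_space UNIV)"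
proof (subst measurable_count_space_eq2, simp, intro conjI ballI)
  fix W :: "'v set"
  have [measurable]: "(\<lambda>alpha. alpha i) \<in> borel_measurable (alpha_measure :: ('v \<times> item \<Rightarrow> real) measure)" for i
  proof -
    have "(\<lambda>alpha. alpha i) \<in> measurable alpha_measure (uniform_measure lborel {0..1::real})"
      unfolding alpha_measure_def by (rule measurable_component_singleton) simp
    then show ?thesis
      by (simp cong: measurable_cong_sets)
  qed
  have "(\<lambda>alpha. {v. alpha (v, X) \<le> c}) -` {W} \<inter> space (alpha_measure :: ('v \<times> item \<Rightarrow> real) measure) =
      {alpha \<in> space alpha_measure. \<forall>v\<in>UNIV. (alpha (v, X) \<le> c) = (v \<in> W)}"
    by auto
  also have "\<dots> \<in> sets alpha_measure"
    by measurable
  finally show "(\<lambda>alpha. {v. alpha (v, X) \<le> c}) -` {W} \<inter> space alpha_measure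
      \<in> sets (alpha_measure :: ('v \<times> item \<Rightarrow> real) measure)" .
qed simp

lemma borel_measurable_threshold_sets:
  fixes F :: "'v::finite set \<Rightarrow> 'v set \<Rightarrow> 'v set \<Rightarrow> real"
  shows "(\<lambda>alpha. F {v. alpha (v, X) \<le> a} {v. alpha (v, Y) \<le> b} {v. alpha (v, Z) \<le> c})
    \<in> borel_measurable alpha_measure"
proof -
  \<comment> \<open>Sets of nodes form a countable type, so a fixed argument of \<open>F\<close> may
    be replaced by a threshold set; this is done for one argument at a time, starting from the
    last.\<close>
  note * = measurable_compose_countable[OF _ measurable_threshold_set]
  have "(\<lambda>alpha. F U V {v. alpha (v, Z) \<le> c}) \<in> borel_measurable alpha_measure" for U V
    by (rule *[where f = "\<lambda>W _. F U V W"]) simp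
  then have "(\<lambda>alpha. F U {v. alpha (v, Y) \<le> b} {v. alpha (v, Z) \<le> c}) \<in> borel_measurable alpha_measure" for U
    by (intro *[where f = "\<lambda>V alpha. F U V {v. alpha (v, Z) \<le> c}"])
  then show ?thesis
    by (intro *[where f = "\<lambda>U alpha. F U {v. alpha (v, Y) \<le> b} {v. alpha (v, Z) \<le> c}"])
qed

lemma num_adopted_le:
  fixes live :: "'v::finite \<times> 'v \<Rightarrow> bool"
  shows "num_adopted Q live \<pi> \<tau> alpha SA SB X \<le> CARD('v)"
  unfolding num_adopted_def by (rule card_mono) auto

lemma integrable_num_adopted:
  fixes live :: "'v::finite \<times> 'v \<Rightarrow> bool"
  assumes "qA0 \<le> qAB"
  shows "integrable alpha_measure
    (\<lambda>alpha. real (num_adopted (qA0, qAB, qB, qB) live \<pi> \<tau> alpha SA SB X))"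
proof -
  interpret prob_space "alpha_measure :: ('v \<times> item \<Rightarrow> real) measure"
    by (rule prob_space_alpha_measure)
  have "(\<lambda>alpha. real (num_adopted (qA0, qAB, qB, qB) live \<pi> \<tau> alpha SA SB X))
      \<in> borel_measurable alpha_measure"
  proof (cases X)
    case IA
    show ?thesis unfolding IA num_adopted_IA[OF assms]
      by (rule borel_measurable_threshold_sets[where
            F = "\<lambda>U V W. real (card (reach live \<pi> (U \<union> V \<inter> reach live \<pi> W `` SB) `` SA))"])
  next
    case IB
    show ?thesis unfolding IB num_adopted_IB[OF assms]
      by (rule borel_measurable_threshold_sets[where F = "\<lambda>_ _ W. real (card (reach live \<pi> W `` SB))"])
  qed
  then show ?thesis
    by (intro integrable_const_bound[where B = "CARD('v)"]) (simp_all add: num_adopted_le)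
qed

text \<open>Both seed sets are functions of \<open>S\<close>, so that one statement covers varying
  either of them while the other is fixed.\<close>

lemma submodular_sigma:
  fixes E :: "('v::finite \<times> 'v) set" and SA SB :: "'v set \<Rightarrow> 'v set"
  assumes "qA0 \<le> qAB"
    and "\<And>live \<pi> \<tau> alpha.
      submodular (\<lambda>S. real (num_adopted (qA0, qAB, qB, qB) live \<pi> \<tau> alpha (SA S) (SB S) X))"
  shows "submodular (\<lambda>S. sigma E p (qA0, qAB, qB, qB) X (SA S) (SB S))"
  unfolding sigma_def
proof (rule submodular_integral)
  interpret \<alpha>: prob_space "alpha_measure :: ('v \<times> item \<Rightarrow> real) measure"
    by (rule prob_space_alpha_measure)
  let ?N = "\<lambda>live \<pi> \<tau> S alpha. real (num_adopted (qA0, qAB, qB, qB) live \<pi> \<tau> alpha (SA S) (SB S) X)"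
  \<comment> \<open>This bound makes the inner integral integrable over the discrete
    outcomes.\<close>
  have bound: "norm (\<integral>alpha. ?N live \<pi> \<tau> S alpha \<partial>alpha_measure) \<le> CARD('v)" for live \<pi> \<tau> S
  proof -
    have "(\<integral>alpha. ?N live \<pi> \<tau> S alpha \<partial>alpha_measure) \<le> CARD('v)"
      by (rule \<alpha>.integral_le_const)
         (auto intro: integrable_num_adopted[OF assms(1)] simp: num_adopted_le)
    then show ?thesis by simp
  qed
  show "integrable (measure_pmf (discrete_outcome E p))
      (\<lambda>\<omega>. case \<omega> of (live, \<pi>, \<tau>) \<Rightarrow> \<integral>alpha. ?N live \<pi> \<tau> S alpha \<partial>alpha_measure)" for S
    by (rule measure_pmf.integrable_const_bound[where B = "CARD('v)"])
       (auto simp: bound simp del: real_norm_def)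
  show "submodular (\<lambda>S. case \<omega> of (live, \<pi>, \<tau>) \<Rightarrow> \<integral>alpha. ?N live \<pi> \<tau> S alpha \<partial>alpha_measure)" for \<omega>
    by (cases \<omega>) (auto intro!: submodular_integral assms integrable_num_adopted)
qed

theorem theorem4:
  fixes E :: "('v::finite \<times> 'v) set" and p :: "'v \<times> 'v \<Rightarrow> real"
    and qA0 qAB qB0 qBA :: real
  assumes "\<forall>e\<in>E. 0 \<le> p e \<and> p e \<le> 1"
    and "0 \<le> qA0" "qA0 \<le> 1" "0 \<le> qAB" "qAB \<le> 1"
    and "0 \<le> qB0" "qB0 \<le> 1" "0 \<le> qBA" "qBA \<le> 1"
    and "qA0 \<le> qAB" and "qB0 = qBA"
  shows "(\<forall>SB. submodular (\<lambda>SA. sigma E p (qA0, qAB, qB0, qBA) IA SA SB))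
       \<and> (\<forall>SA SA' SB. sigma E p (qA0, qAB, qB0, qBA) IB SA SB
                     = sigma E p (qA0, qAB, qB0, qBA) IB SA' SB)
       \<and> (\<forall>SA. submodular (\<lambda>SB. sigma E p (qA0, qAB, qB0, qBA) IB SA SB))"
proof (intro conjI allI)
  note q = \<open>qA0 \<le> qAB\<close>
  show "submodular (\<lambda>SA. sigma E p (qA0, qAB, qB0, qBA) IA SA SB)" for SB
    unfolding \<open>qB0 = qBA\<close>
    by (rule submodular_sigma[OF q, where SA = "\<lambda>S. S" and SB = "\<lambda>_. SB"])
       (simp only: num_adopted_IA[OF q] submodular_card_Image)
  show "submodular (\<lambda>SB. sigma E p (qA0, qAB, qB0, qBA) IB SA SB)" for SA
    unfolding \<open>qB0 = qBA\<close>
    by (rule submodular_sigma[OF q, where SA = "\<lambda>_. SA" and SB = "\<lambda>S. S"])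
       (simp only: num_adopted_IB[OF q] submodular_card_Image)
  show "sigma E p (qA0, qAB, qB0, qBA) IB SA SB = sigma E p (qA0, qAB, qB0, qBA) IB SA' SB" for SA SA' SB
    unfolding \<open>qB0 = qBA\<close> sigma_def num_adopted_IB[OF q] ..
qed

end
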